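(* For any $n\in\mathbb{N}$ with $n>1$, there is no $p\in\beta\mathbb{N}$ with $p\star_n p=p$ and $p\in K(\beta\mathbb{N},+)\cup E(\beta\mathbb{N},+)$.
   Context: $\beta\mathbb{N}$ is the set of ultrafilters on $\mathbb{N}$, with the extended addition: $B\in p+r$ iff $\{x:\{y:x+y\in B\}\in r\}\in p$. $K(\beta\mathbb{N},+)$ is the smallest two-sided ideal of $(\beta\mathbb{N},+)$ and $E(\beta\mathbb{N},+)$ its set of idempotents ($p+p=p$). For $p,q\in\beta\mathbb{N}$, $p\star_n q$ is defined by $B\in p\star_n q$ iff $\{a\in\mathbb{N}:\{b\in\mathbb{N}:n^a b\in B\}\in q\}\in p$. *)

theory Defs
  imports Complex_Main
begin

(* An ultrafilter is represented by a value p of the library type of filters, with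
   "B belongs to p" rendered as "eventually (%x. x : B) p".  Here N is the set of
   positive integers, so an ultrafilter on N is an ultrafilter on nat that contains {1..}.
   (With 0 allowed, the principal ultrafilter at 0 would be both an additive idempotent
   and an idempotent for every star operation.) *)

definition ultrafilter :: "'a filter \<Rightarrow> bool" where
  "ultrafilter p \<longleftrightarrow>
     p \<noteq> bot \<and> (\<forall>P. eventually P p \<or> eventually (\<lambda>x. \<not> P x) p)"

definition betaN :: "nat filter set" where
  "betaN = {p. ultrafilter p \<and> eventually (\<lambda>x. x \<in> {1..}) p}"

(* The extension of an operation f from points to ultrafilters:
   B belongs to beta_ext f p q iff {x. {y. f x y : B} belongs to q} belongs to p. *)

definition beta_ext :: "('a \<Rightarrow> 'b \<Rightarrow> 'c) \<Rightarrow> 'a filter \<Rightarrow> 'b filter \<Rightarrow> 'c filter" where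
  "beta_ext f p q = Abs_filter (\<lambda>P. eventually (\<lambda>x. eventually (\<lambda>y. P (f x y)) q) p)"

lemma eventually_beta_ext:
  fixes f :: "'a \<Rightarrow> 'b \<Rightarrow> 'c"
  shows "eventually P (beta_ext f p q) \<longleftrightarrow> eventually (\<lambda>x. eventually (\<lambda>y. P (f x y)) q) p"
  unfolding beta_ext_def
proof (rule eventually_Abs_filter, rule is_filter.intro)
  fix P Q :: "'c \<Rightarrow> bool"
  assume "eventually (\<lambda>x. eventually (\<lambda>y. P (f x y)) q) p"
    and "eventually (\<lambda>x. eventually (\<lambda>y. Q (f x y)) q) p"
  then show "eventually (\<lambda>x. eventually (\<lambda>y. P (f x y) \<and> Q (f x y)) q) p"
    by (simp add: eventually_conj_iff)
next
  fix P Q :: "'c \<Rightarrow> bool"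
  assume "\<forall>x. P x \<longrightarrow> Q x" and "eventually (\<lambda>x. eventually (\<lambda>y. P (f x y)) q) p"
  then show "eventually (\<lambda>x. eventually (\<lambda>y. Q (f x y)) q) p"
    by (auto elim!: eventually_mono)
qed simp

definition beta_add :: "nat filter \<Rightarrow> nat filter \<Rightarrow> nat filter" where
  "beta_add = beta_ext (\<lambda>x y. x + y)"

definition beta_star :: "nat \<Rightarrow> nat filter \<Rightarrow> nat filter \<Rightarrow> nat filter" where
  "beta_star n = beta_ext (\<lambda>a b. n ^ a * b)"

lemma mem_beta_add:
  "eventually (\<lambda>z. z \<in> B) (beta_add p r) \<longleftrightarrow>
     eventually (\<lambda>x. x \<in> {x. eventually (\<lambda>y. y \<in> {y. x + y \<in> B}) r}) p"
  by (simp add: beta_add_def eventually_beta_ext)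

lemma mem_beta_star:
  "eventually (\<lambda>z. z \<in> B) (beta_star n p q) \<longleftrightarrow>
     eventually (\<lambda>a. a \<in> {a. eventually (\<lambda>b. b \<in> {b. n ^ a * b \<in> B}) q}) p"
  by (simp add: beta_star_def eventually_beta_ext)

lemma ultrafilter_iff:
  "ultrafilter p \<longleftrightarrow> (\<forall>P. eventually (\<lambda>x. \<not> P x) p \<longleftrightarrow> \<not> eventually P p)"
proof
  assume u: "ultrafilter p"
  show "\<forall>P. eventually (\<lambda>x. \<not> P x) p \<longleftrightarrow> \<not> eventually P p"
  proof
    fix P
    have "\<not> (eventually P p \<and> eventually (\<lambda>x. \<not> P x) p)"
      using u unfolding ultrafilter_def eventually_conj_iff[symmetric]
      by (simp add: eventually_False)
    then show "eventually (\<lambda>x. \<not> P x) p \<longleftrightarrow> \<not> eventually P p"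
      using u by (auto simp: ultrafilter_def)
  qed
next
  assume *: "\<forall>P. eventually (\<lambda>x. \<not> P x) p \<longleftrightarrow> \<not> eventually P p"
  from spec[OF this, of "\<lambda>_. False"] have "p \<noteq> bot"
    by (simp add: eventually_False)
  with * show "ultrafilter p" by (auto simp: ultrafilter_def)
qed

lemma ultrafilter_beta_ext:
  assumes "ultrafilter p" "ultrafilter q"
  shows "ultrafilter (beta_ext f p q)"
  using assms by (simp add: ultrafilter_iff eventually_beta_ext)

lemma beta_add_closed:
  assumes "p \<in> betaN" "q \<in> betaN"
  shows "beta_add p q \<in> betaN"
  using assms
  by (auto simp: betaN_def beta_add_def ultrafilter_beta_ext eventually_beta_ext
      elim!: eventually_mono)

definition two_sided_ideal :: "nat filter set \<Rightarrow> bool" where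
  "two_sided_ideal I \<longleftrightarrow>
     I \<noteq> {} \<and> I \<subseteq> betaN \<and>
     (\<forall>p\<in>I. \<forall>q\<in>betaN. beta_add q p \<in> I \<and> beta_add p q \<in> I)"

(* LEAST refers to the inclusion order; a smallest two-sided ideal exists because
   the compact right topological semigroup beta N has a minimal left ideal. *)

definition K_beta :: "nat filter set" where
  "K_beta = (LEAST I. two_sided_ideal I)"

definition E_beta :: "nat filter set" where
  "E_beta = {p \<in> betaN. beta_add p p = p}"

end

theory Submission
  imports Defs
begin

text \<open>
  Let \<open>W x\<close> and \<open>L x\<close> be the least exponents \<open>k\<close> with \<open>\<not> n ^ k dvd x\<close> and \<open>x < n ^ k\<close>. Both turn
  \<open>n ^ a * b\<close> into \<open>a + \<dots>\<close>. If \<open>p\<close> is a \<open>\<star>\<^sub>n\<close>-idempotent, then \<open>p\<close>-most \<open>x\<close> look like \<open>n ^ a * b\<close>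
  with \<open>b\<close> generic over \<open>a\<close>, so the \<open>n\<close>-adic distance of \<open>L x\<close> from the \<open>n\<close>-adic limit of \<open>L\<close>
  along \<open>p\<close> is determined by \<open>W a\<close>, and likewise for \<open>W x\<close>: the two distances agree for \<open>p\<close>-most
  \<open>x\<close>, and they are not constant since \<open>p\<close> contains all sets of multiples of \<open>n ^ k\<close>.
  If moreover \<open>p = r + p\<close>, then \<open>p\<close>-most \<open>x\<close> look like \<open>a + b\<close> where \<open>L (a + b) = L b\<close> depends
  only on \<open>b\<close> and \<open>W (a + b) = W a\<close> only on \<open>a\<close>, which forces the common distance to be constant.
  Every element of \<open>K(\<beta>\<nat>)\<close> lies in a minimal left ideal and hence is of the form \<open>p = r + p\<close>.
\<close>

section \<open>Filters and ultrafilters\<close>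

text \<open>Zorn's lemma for the reversed order: a finer filter is smaller, so minimal filters are
  sought, both for ultrafilters and for minimal left ideals.\<close>

lemma filter_Zorn:
  fixes S :: "'a filter set"
  assumes "S \<noteq> {}"
    and chain: "\<And>C. C \<subseteq> S \<Longrightarrow> C \<noteq> {} \<Longrightarrow> (\<And>F G. F \<in> C \<Longrightarrow> G \<in> C \<Longrightarrow> F \<le> G \<or> G \<le> F)
      \<Longrightarrow> \<exists>B\<in>S. \<forall>F\<in>C. B \<le> F"
  shows "\<exists>M\<in>S. \<forall>F\<in>S. F \<le> M \<longrightarrow> F = M"
proof -
  have "\<exists>M\<in>S. \<forall>F\<in>S. M \<ge> F \<longrightarrow> F = M"
  proof (rule predicate_Zorn)
    show "partial_order_on S (relation_of (\<ge>) S)"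
      by (auto intro: partial_order_on_relation_ofI)
    fix C assume C: "C \<in> Chains (relation_of (\<ge>) S)"
    show "\<exists>u\<in>S. \<forall>a\<in>C. a \<ge> u"
    proof (cases "C = {}")
      case True
      then show ?thesis using \<open>S \<noteq> {}\<close> by auto
    next
      case False
      then show ?thesis using C chain[of C] by (fastforce simp: Chains_def relation_of_def)
    qed
  qed
  then show ?thesis .
qed

text \<open>A chain is a filter base, so \<open>False\<close> can hold eventually in the infimum
  only if it does in some member. This is the compactness behind both uses of Zorn's lemma.\<close>

lemma Inf_chain_neq_bot:
  fixes C :: "'a filter set"
  assumes "C \<noteq> {}" "bot \<notin> C" and "\<And>F G. F \<in> C \<Longrightarrow> G \<in> C \<Longrightarrow> F \<le> G \<or> G \<le> F"
  shows "Inf C \<noteq> bot"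
proof -
  have "eventually (\<lambda>_. False) (Inf C) \<longleftrightarrow> (\<exists>b\<in>C. eventually (\<lambda>_. False) b)"
  proof (rule eventually_Inf_base)
    fix F G assume "F \<in> C" "G \<in> C"
    then show "\<exists>B\<in>C. B \<le> inf F G" using assms(3)[of F G] by (auto intro: bexI[of _ F] bexI[of _ G])
  qed fact
  then show ?thesis using assms(2) by (metis trivial_limit_def)
qed

lemma ex_ultrafilter_le:
  assumes "F \<noteq> bot"
  shows "\<exists>U. ultrafilter U \<and> U \<le> F"
proof -
  have "\<exists>M\<in>{G. G \<noteq> bot \<and> G \<le> F}. \<forall>G\<in>{G. G \<noteq> bot \<and> G \<le> F}. G \<le> M \<longrightarrow> G = M"
  proof (rule filter_Zorn)
    show "{G. G \<noteq> bot \<and> G \<le> F} \<noteq> {}" using assms by auto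
    fix C assume C: "C \<subseteq> {G. G \<noteq> bot \<and> G \<le> F}" "C \<noteq> {}"
      and chain: "\<And>F G. F \<in> C \<Longrightarrow> G \<in> C \<Longrightarrow> F \<le> G \<or> G \<le> F"
    have "Inf C \<noteq> bot" using C chain by (intro Inf_chain_neq_bot) auto
    moreover obtain G where "G \<in> C" "G \<le> F" using C by auto
    then have "Inf C \<le> F" by (rule Inf_lower2)
    ultimately show "\<exists>B\<in>{G. G \<noteq> bot \<and> G \<le> F}. \<forall>G\<in>C. B \<le> G"
      by (intro bexI[of _ "Inf C"] ballI Inf_lower) simp_all
  qed
  then obtain M where M: "M \<noteq> bot" "M \<le> F"
    and "\<forall>G. G \<noteq> bot \<and> G \<le> F \<longrightarrow> G \<le> M \<longrightarrow> G = M" by blast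
  then have min: "\<And>G. G \<noteq> bot \<Longrightarrow> G \<le> M \<Longrightarrow> G = M" by (meson order_trans)
  \<comment> \<open>By minimality, restricting \<open>M\<close> to the set where \<open>P\<close>
    holds yields either \<open>bot\<close> or \<open>M\<close> itself.\<close>
  have "eventually P M \<or> eventually (\<lambda>x. \<not> P x) M" for P
  proof (cases "inf M (principal {x. P x}) = bot")
    case True
    then have "eventually (\<lambda>_. False) (inf M (principal {x. P x}))" by simp
    then show ?thesis by (simp add: eventually_inf_principal)
  next
    case False
    then have "inf M (principal {x. P x}) = M" using min by simp
    then have "M \<le> principal {x. P x}" by (metis inf.cobounded2)
    then show ?thesis by (simp add: le_principal)
  qed
  with M show ?thesis unfolding ultrafilter_def by blast
qed

lemma ultrafilter_le_eq:
  assumes "ultrafilter p" "q \<noteq> bot" "q \<le> p"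
  shows "q = p"
proof (rule antisym[OF assms(3)])
  show "p \<le> q"
  proof (rule filter_leI)
    fix P assume P: "eventually P q"
    show "eventually P p"
    proof (rule ccontr)
      assume "\<not> eventually P p"
      then have "eventually (\<lambda>x. \<not> P x) q"
        using assms by (auto simp: ultrafilter_def filter_leD)
      with P have "eventually (\<lambda>_. False) q" by eventually_elim auto
      with assms(2) show False by (simp add: trivial_limit_def)
    qed
  qed
qed

lemma ultrafilter_finite_range:
  assumes "ultrafilter p" "finite A" "\<And>x. h x \<in> A"
  shows "\<exists>c. eventually (\<lambda>x. h x = c) p"
proof (rule ccontr)
  assume "\<nexists>c. eventually (\<lambda>x. h x = c) p"
  then have "\<forall>c\<in>A. eventually (\<lambda>x. h x \<noteq> c) p" using assms(1) by (auto simp: ultrafilter_iff)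
  then have "eventually (\<lambda>x. \<forall>c\<in>A. h x \<noteq> c) p" using assms(2) by (simp add: eventually_ball_finite)
  then have "eventually (\<lambda>x. False) p" by eventually_elim (use assms(3) in blast)
  then show False using assms(1) by (simp add: ultrafilter_def trivial_limit_def)
qed

section \<open>The smallest ideal\<close>

lemma betaN_iff: "p \<in> betaN \<longleftrightarrow> ultrafilter p \<and> p \<le> principal {1..}"
  by (simp add: betaN_def le_principal)

lemma eventually_beta_add:
  "eventually P (beta_add p q) \<longleftrightarrow> eventually (\<lambda>x. eventually (\<lambda>y. P (x + y)) q) p"
  by (simp add: beta_add_def eventually_beta_ext)

lemma beta_add_assoc: "beta_add (beta_add p q) r = beta_add p (beta_add q r)"
  by (simp add: filter_eq_iff eventually_beta_add add.assoc)

text \<open>A closed set of ultrafilters is encoded by the filter of sets common to its members. For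
  \<open>x\<close> in \<open>betaN\<close> this one encodes the left ideal \<beta>N + x, so
  inclusion of such ideals becomes \<open>\<le>\<close>.\<close>

definition left_ideal_filter :: "nat filter \<Rightarrow> nat filter" where
  "left_ideal_filter x = beta_add (principal {1..}) x"

lemma eventually_left_ideal_filter:
  "eventually P (left_ideal_filter x) \<longleftrightarrow> (\<forall>a\<ge>1. eventually (\<lambda>y. P (a + y)) x)"
  by (auto simp: left_ideal_filter_def eventually_beta_add eventually_principal)

lemma beta_add_le_left_ideal_filter:
  assumes "r \<in> betaN"
  shows "beta_add r x \<le> left_ideal_filter x"
  using assms by (auto intro!: filter_leI simp: eventually_left_ideal_filter eventually_beta_add betaN_def
      elim!: eventually_mono)

lemma left_ideal_filter_mono:
  assumes "y \<le> left_ideal_filter x"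
  shows "left_ideal_filter y \<le> left_ideal_filter x"
proof (rule filter_leI)
  fix P assume P: "eventually P (left_ideal_filter x)"
  show "eventually P (left_ideal_filter y)"
    unfolding eventually_left_ideal_filter
  proof (intro allI impI)
    fix a :: nat assume "a \<ge> 1"
    have "eventually (\<lambda>z. P (a + z)) (left_ideal_filter x)"
      unfolding eventually_left_ideal_filter
    proof (intro allI impI)
      fix b :: nat assume "b \<ge> 1"
      then have "eventually (\<lambda>y. P ((a + b) + y)) x"
        using P by (simp add: eventually_left_ideal_filter)
      then show "eventually (\<lambda>y. P (a + (b + y))) x" by (simp add: add.assoc)
    qed
    then show "eventually (\<lambda>z. P (a + z)) y" using assms by (rule filter_leD[rotated])
  qed
qed

text \<open>The left ideal \<open>\<beta>\<nat> + x\<close> is closed, being a continuous image of a compact space.\<close>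

lemma le_left_ideal_filterD:
  assumes "ultrafilter y" "ultrafilter x" "y \<le> left_ideal_filter x"
  shows "\<exists>r\<in>betaN. y = beta_add r x"
proof -
  define S where "S P = {a. a \<ge> 1 \<and> eventually (\<lambda>b. P (a + b)) x}" for P
  \<comment> \<open>An ultrafilter \<open>r\<close> finer than \<open>G\<close> contains every
    \<open>S P\<close>, which says exactly that \<open>beta_add r x \<le> y\<close>; between
    ultrafilters this is equality.\<close>
  define G where "G = (INF P\<in>{P. eventually P y}. principal (S P))"
  have "S P \<noteq> {}" if P: "eventually P y" for P
  proof
    assume "S P = {}"
    then have "eventually (\<lambda>z. \<not> P z) (left_ideal_filter x)"
      using assms(2) by (auto simp: S_def eventually_left_ideal_filter ultrafilter_iff)
    then have "eventually (\<lambda>z. \<not> P z) y" using assms(3) by (rule filter_leD[rotated])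
    then show False using P assms(1) by (simp add: ultrafilter_iff)
  qed
  moreover have "eventually (\<lambda>_. False) G \<longleftrightarrow>
      (\<exists>P\<in>{P. eventually P y}. eventually (\<lambda>_. False) (principal (S P)))"
    unfolding G_def
  proof (rule eventually_INF_base)
    show "{P. eventually P y} \<noteq> {}" by (auto intro!: exI[of _ "\<lambda>_. True"])
    fix P Q assume "P \<in> {P. eventually P y}" "Q \<in> {P. eventually P y}"
    then have "(\<lambda>z. P z \<and> Q z) \<in> {P. eventually P y}" by (simp add: eventually_conj)
    moreover have "principal (S (\<lambda>z. P z \<and> Q z)) \<le> inf (principal (S P)) (principal (S Q))"
      by (auto simp: S_def eventually_conj_iff)
    ultimately show "\<exists>R\<in>{P. eventually P y}. principal (S R) \<le> inf (principal (S P)) (principal (S Q))"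
      by blast
  qed
  ultimately have "G \<noteq> bot" by (auto simp: trivial_limit_def eventually_principal)
  then obtain r where r: "ultrafilter r" "r \<le> G" using ex_ultrafilter_le by blast
  have ev: "eventually (\<lambda>a. a \<in> S P) r" if "eventually P y" for P
  proof -
    have "G \<le> principal (S P)" unfolding G_def using that by (intro INF_lower) simp
    then show ?thesis using r(2) by (auto simp: le_principal dest: filter_leD)
  qed
  have "r \<in> betaN" using r(1) ev[of "\<lambda>_. True"] by (simp add: betaN_def S_def)
  moreover have "beta_add r x \<le> y"
  proof (rule filter_leI)
    fix P assume "eventually P y"
    from ev[OF this] show "eventually P (beta_add r x)"
      unfolding eventually_beta_add by eventually_elim (simp add: S_def)
  qed
  moreover have "ultrafilter (beta_add r x)"
    using r(1) assms(2) by (simp add: beta_add_def ultrafilter_beta_ext)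
  ultimately show ?thesis
    using ultrafilter_le_eq[OF assms(1)] by (metis ultrafilter_def)
qed

lemma left_ideal_filter_le:
  assumes "x \<in> betaN"
  shows "left_ideal_filter x \<le> principal {1..}"
  using assms by (auto simp: le_principal eventually_left_ideal_filter)

lemma left_ideal_filter_neq_bot:
  assumes "x \<in> betaN"
  shows "left_ideal_filter x \<noteq> bot"
  using assms by (auto simp: betaN_def ultrafilter_def trivial_limit_def eventually_left_ideal_filter)

lemma betaN_nonempty: "\<exists>x. x \<in> betaN"
proof -
  have "principal {1::nat..} \<noteq> bot" by (simp add: principal_eq_bot_iff)
  then show ?thesis using ex_ultrafilter_le by (auto simp: betaN_iff)
qed

lemma ex_minimal_left_ideal:
  obtains x where "x \<in> betaN"
    and "\<And>y. y \<in> betaN \<Longrightarrow> y \<le> left_ideal_filter x \<Longrightarrow> left_ideal_filter y = left_ideal_filter x"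
proof -
  have "\<exists>M\<in>left_ideal_filter ` betaN. \<forall>F\<in>left_ideal_filter ` betaN. F \<le> M \<longrightarrow> F = M"
  proof (rule filter_Zorn)
    show "left_ideal_filter ` betaN \<noteq> {}" using betaN_nonempty by blast
    fix C assume C: "C \<subseteq> left_ideal_filter ` betaN" "C \<noteq> {}"
      and chain: "\<And>F G. F \<in> C \<Longrightarrow> G \<in> C \<Longrightarrow> F \<le> G \<or> G \<le> F"
    have "bot \<notin> C" using C(1) left_ideal_filter_neq_bot by fastforce
    then have "Inf C \<noteq> bot" using C(2) chain by (intro Inf_chain_neq_bot) auto
    \<comment> \<open>Such a \<open>y\<close> is a common point of all ideals in the chain, so the
      left ideal it generates is a lower bound.\<close>
    then obtain y where y: "ultrafilter y" "y \<le> Inf C" using ex_ultrafilter_le by blast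
    then have le: "y \<le> F" if "F \<in> C" for F using that by (simp add: le_Inf_iff)
    obtain x where "left_ideal_filter x \<in> C" "x \<in> betaN" using C by blast
    then have "y \<in> betaN"
      using y(1) order_trans[OF le left_ideal_filter_le] by (simp add: betaN_iff)
    moreover have "left_ideal_filter y \<le> F" if "F \<in> C" for F
      using left_ideal_filter_mono le[OF that] C(1) that by blast
    ultimately show "\<exists>B\<in>left_ideal_filter ` betaN. \<forall>F\<in>C. B \<le> F" by blast
  qed
  then show ?thesis using that left_ideal_filter_mono by blast
qed

text \<open>If \<open>L\<close> is a minimal left ideal, the smallest ideal is L + \<beta>N. Each
  \<open>y\<close> in \<open>L\<close> generates \<open>L\<close>, hence y = r + y for some
  \<open>r\<close>, and adding \<open>s\<close> on the right preserves this.\<close>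

lemma K_beta_left_fixed:
  assumes "p \<in> K_beta"
  shows "\<exists>r\<in>betaN. p = beta_add r p"
proof -
  obtain x where x: "x \<in> betaN"
    and min: "\<And>y. y \<in> betaN \<Longrightarrow> y \<le> left_ideal_filter x \<Longrightarrow> left_ideal_filter y = left_ideal_filter x"
    using ex_minimal_left_ideal by blast
  define L where "L = {y \<in> betaN. y \<le> left_ideal_filter x}"
  have L_add: "beta_add q y \<in> L" if "q \<in> betaN" "y \<in> L" for q y
    using that beta_add_le_left_ideal_filter[of q y] min[of y] by (simp add: L_def beta_add_closed)
  have L_gen: "\<exists>r\<in>betaN. z = beta_add r y" if "y \<in> L" "z \<in> L" for y z
    using that min[of y] le_left_ideal_filterD[of z y] by (simp add: L_def betaN_def)
  define K where "K = {beta_add y r | y r. y \<in> L \<and> r \<in> betaN}"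
  have "beta_add x x \<in> L"
    using x beta_add_le_left_ideal_filter[OF x] by (auto simp: L_def beta_add_closed)
  then have "K \<noteq> {}" using x by (auto simp: K_def)
  moreover have "K \<subseteq> betaN" by (auto simp: K_def L_def beta_add_closed)
  moreover have "beta_add q u \<in> K \<and> beta_add u q \<in> K" if uq: "u \<in> K" "q \<in> betaN" for u q
  proof -
    obtain y s where u: "u = beta_add y s" "y \<in> L" "s \<in> betaN" using uq(1) by (auto simp: K_def)
    have "beta_add q u = beta_add (beta_add q y) s" "beta_add u q = beta_add y (beta_add s q)"
      by (simp_all add: u(1) beta_add_assoc)
    then show ?thesis using u(2,3) uq(2) L_add beta_add_closed unfolding K_def by blast
  qed
  ultimately have "two_sided_ideal K" by (auto simp: two_sided_ideal_def)
  moreover have "K \<subseteq> I" if I: "two_sided_ideal I" for I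
  proof -
    have "L \<subseteq> I"
    proof
      fix z assume z: "z \<in> L"
      obtain i where i: "i \<in> I" "i \<in> betaN" using I by (auto simp: two_sided_ideal_def)
      \<comment> \<open>This element lies in both \<open>L\<close> and \<open>I\<close>; by
        minimality it generates \<open>L\<close>, so it carries all of \<open>L\<close> into
        \<open>I\<close>.\<close>
      have y: "beta_add i z \<in> L" "beta_add i z \<in> I"
        using L_add[OF i(2) z] I i(1) z by (auto simp: two_sided_ideal_def L_def)
      obtain r where "r \<in> betaN" "z = beta_add r (beta_add i z)" using L_gen[OF y(1) z] by blast
      then show "z \<in> I" using I y(2) by (metis two_sided_ideal_def)
    qed
    then show ?thesis using I by (auto simp: K_def two_sided_ideal_def)
  qed
  ultimately have "K_beta = K" unfolding K_beta_def by (intro Least_equality) auto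
  with assms have "p \<in> K" by simp
  then obtain y s where ys: "y \<in> L" "s \<in> betaN" "p = beta_add y s" unfolding K_def by blast
  obtain r where "r \<in> betaN" "y = beta_add r y" using L_gen[OF ys(1) ys(1)] by blast
  then show ?thesis using ys(3) by (metis beta_add_assoc)
qed

section \<open>Exponents\<close>

text \<open>This is \<open>W\<close> of the overview: for \<open>n > 1\<close> and
  \<open>x > 0\<close>, one more than the number of trailing zeros of \<open>x\<close> in base
  \<open>n\<close>.\<close>

definition ndvd_exp :: "nat \<Rightarrow> nat \<Rightarrow> nat" where
  "ndvd_exp n x = (LEAST k. \<not> n ^ k dvd x)"

text \<open>This is \<open>L\<close> of the overview: for \<open>n > 1\<close>, the number of base
  \<open>n\<close> digits of \<open>x\<close>.\<close>

definition less_exp :: "nat \<Rightarrow> nat \<Rightarrow> nat" where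
  "less_exp n x = (LEAST k. x < n ^ k)"

lemma less_ndvd_exp_iff:
  assumes "n > 1" "x > 0"
  shows "k < ndvd_exp n x \<longleftrightarrow> n ^ k dvd x"
proof -
  have "\<not> n ^ x dvd x"
    using assms power_gt_expt[of n x] by (auto dest: dvd_imp_le)
  then have "\<not> n ^ ndvd_exp n x dvd x" unfolding ndvd_exp_def by (rule LeastI)
  then show ?thesis
    by (metis dvd_trans le_imp_power_dvd linorder_not_le ndvd_exp_def not_less_Least)
qed

lemma less_exp_le_iff:
  assumes "n > 1"
  shows "less_exp n x \<le> k \<longleftrightarrow> x < n ^ k"
proof -
  have "x < n ^ x" using assms by (simp add: power_gt_expt)
  then have "x < n ^ less_exp n x" unfolding less_exp_def by (rule LeastI)
  then show ?thesis using assms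
    by (metis Least_le less_exp_def less_le_trans power_increasing_iff)
qed

lemma nat_eq_less_iffI: "(\<And>k::nat. k < a \<longleftrightarrow> k < b) \<Longrightarrow> a = b"
  by (metis linorder_neq_iff)

lemma ndvd_exp_mult_power:
  assumes "n > 1" "x > 0"
  shows "ndvd_exp n (n ^ a * x) = a + ndvd_exp n x"
proof (rule nat_eq_less_iffI)
  fix k
  show "k < ndvd_exp n (n ^ a * x) \<longleftrightarrow> k < a + ndvd_exp n x"
  proof (cases "k \<le> a")
    case True
    moreover have "0 < ndvd_exp n x" using assms by (simp add: less_ndvd_exp_iff)
    then have "k < a + ndvd_exp n x" using True by linarith
    ultimately show ?thesis using assms by (simp add: less_ndvd_exp_iff le_imp_power_dvd)
  next
    case False
    then obtain j where "k = a + j" by (metis le_Suc_ex nat_le_linear)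
    then show ?thesis using assms by (simp add: less_ndvd_exp_iff power_add)
  qed
qed

lemma less_exp_mult_power:
  assumes "n > 1" "x > 0"
  shows "less_exp n (n ^ a * x) = a + less_exp n x"
proof (rule nat_eq_less_iffI)
  fix k
  have "less_exp n (n ^ a * x) \<le> k \<longleftrightarrow> a + less_exp n x \<le> k"
  proof (cases "k \<le> a")
    case True
    moreover have "\<not> less_exp n x \<le> 0" using assms by (simp add: less_exp_le_iff del: le_zero_eq)
    moreover have "n ^ k \<le> n ^ a * x"
      using assms True by (metis One_nat_def Suc_leI less_imp_le mult.right_neutral mult_le_mono power_increasing)
    ultimately show ?thesis using assms by (simp add: less_exp_le_iff)
  next
    case False
    then obtain j where "k = a + j" by (metis le_Suc_ex nat_le_linear)
    then show ?thesis using assms by (simp add: less_exp_le_iff power_add)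
  qed
  then show "k < less_exp n (n ^ a * x) \<longleftrightarrow> k < a + less_exp n x" by linarith
qed

text \<open>Since a < n^a, the lowest nonzero digit of \<open>a\<close> sits below position
  \<open>a\<close>, where \<open>b\<close> has only zeros.\<close>

lemma ndvd_exp_add:
  assumes "n > 1" "a > 0" "n ^ a dvd b"
  shows "ndvd_exp n (a + b) = ndvd_exp n a"
proof -
  have "\<not> n ^ a dvd a" using assms power_gt_expt[of n a] by (auto dest: dvd_imp_le)
  then have "n ^ k dvd a + b \<longleftrightarrow> n ^ k dvd a" for k
    using assms(3)
    by (metis dvd_add_left_iff dvd_trans le_imp_power_dvd nat_le_linear)
  then show ?thesis by (simp add: ndvd_exp_def)
qed

text \<open>The gap from \<open>b\<close> up to a larger power of \<open>n\<close> is a positive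
  multiple of n^a, hence exceeds \<open>a\<close>: adding \<open>a\<close> causes no carry into a
  new digit.\<close>

lemma less_exp_add:
  assumes "n > 1" "b > 0" "n ^ a dvd b"
  shows "less_exp n (a + b) = less_exp n b"
proof -
  have "a + b < n ^ k" if "b < n ^ k" for k
  proof -
    have "n ^ a < n ^ k" using assms that by (meson dvd_imp_le le_less_trans)
    then have "n ^ a dvd n ^ k" using assms(1) by (simp add: le_imp_power_dvd)
    then have "n ^ a dvd n ^ k - b" using assms(3) by (rule dvd_diff_nat)
    then have "n ^ a \<le> n ^ k - b" using that by (simp add: dvd_imp_le)
    moreover have "a < n ^ a" using assms(1) by (simp add: power_gt_expt)
    ultimately show ?thesis by linarith
  qed
  then have "a + b < n ^ k \<longleftrightarrow> b < n ^ k" for k by (metis add.commute add_lessD1)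
  then show ?thesis by (simp add: less_exp_def)
qed

section \<open>Idempotents of the star operation\<close>

lemma eventually_beta_star:
  "eventually P (beta_star n p q) \<longleftrightarrow> eventually (\<lambda>a. eventually (\<lambda>b. P (n ^ a * b)) q) p"
  by (simp add: beta_star_def eventually_beta_ext)

text \<open>Each application of the star operation contributes a factor n^a with a \<ge> 1, which
  raises the exponent by at least one.\<close>

lemma star_idem_dvd:
  assumes "p \<in> betaN" "beta_star n p p = p"
  shows "eventually (\<lambda>x. n ^ k dvd x) p"
proof (induction k)
  case (Suc k)
  have pos: "eventually (\<lambda>x. x \<ge> 1) p" using assms(1) by (simp add: betaN_def)
  have "eventually (\<lambda>x. n ^ Suc k dvd x) (beta_star n p p)"
    unfolding eventually_beta_star using pos
  proof eventually_elim
    case (elim a)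
    show ?case using Suc
    proof eventually_elim
      case (elim b)
      have "n dvd n ^ a" using \<open>a \<ge> 1\<close> by (simp add: dvd_power)
      then show ?case using elim by (simp add: mult_dvd_mono)
    qed
  qed
  then show ?case using assms(2) by simp
qed simp

text \<open>
  The sequence \<open>c\<close> is the \<open>n\<close>-adic limit of \<open>f\<close> along \<open>p\<close>, and the \<open>LEAST\<close> term measures how far
  \<open>f x\<close> is from it.
\<close>

lemma star_shift_distance:
  fixes f :: "nat \<Rightarrow> nat"
  assumes n: "n > 1" and p: "p \<in> betaN"
    and shift: "\<And>a x. x > 0 \<Longrightarrow> f (n ^ a * x) = a + f x"
  shows "\<exists>c. eventually (\<lambda>a. eventually
    (\<lambda>b. (LEAST k. f (n ^ a * b) mod n ^ k \<noteq> c k) = ndvd_exp n a) p) p"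
proof -
  have u: "ultrafilter p" and pos: "eventually (\<lambda>x. x \<ge> 1) p" using p by (auto simp: betaN_def)
  have "\<exists>c. eventually (\<lambda>x. f x mod n ^ k = c) p" for k
    using n by (intro ultrafilter_finite_range[OF u, of "{..<n ^ k}"]) auto
  then obtain c where c: "\<And>k. eventually (\<lambda>x. f x mod n ^ k = c k) p" by metis
  have "eventually (\<lambda>a. eventually
    (\<lambda>b. (LEAST k. f (n ^ a * b) mod n ^ k \<noteq> c k) = ndvd_exp n a) p) p"
    using pos
  proof eventually_elim
    case (elim a)
    \<comment> \<open>Finitely many \<open>k\<close> suffice once \<open>a\<close> is fixed; the
      endpoint is included because the first disagreement occurs exactly there.\<close>
    have "eventually (\<lambda>b. \<forall>k\<in>{..ndvd_exp n a}. f b mod n ^ k = c k) p"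
      using c by (intro eventually_ball_finite) auto
    then show ?case using pos
    proof eventually_elim
      case (elim b)
      have iff: "f (n ^ a * b) mod n ^ k \<noteq> c k \<longleftrightarrow> \<not> k < ndvd_exp n a" if "k \<le> ndvd_exp n a" for k
      proof -
        have "f (n ^ a * b) mod n ^ k = c k \<longleftrightarrow> (a + f b) mod n ^ k = f b mod n ^ k"
          using elim shift that by simp
        also have "\<dots> \<longleftrightarrow> n ^ k dvd a"
          using mod_eq_dvd_iff_nat[of "f b" "a + f b" "n ^ k"] by simp
        finally show ?thesis using n \<open>a \<ge> 1\<close> by (simp add: less_ndvd_exp_iff)
      qed
      show ?case
      proof (rule Least_equality)
        show "f (n ^ a * b) mod n ^ ndvd_exp n a \<noteq> c (ndvd_exp n a)" using iff by blast
      next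
        fix k assume "f (n ^ a * b) mod n ^ k \<noteq> c k"
        then show "ndvd_exp n a \<le> k" using iff by (meson less_imp_le not_le)
      qed
    qed
  qed
  then show ?thesis by blast
qed

lemma star_idem_not_left_fixed:
  assumes n: "n > 1" and p: "p \<in> betaN" and idem: "beta_star n p p = p"
    and r: "r \<in> betaN" and fixed: "p = beta_add r p"
  shows False
proof -
  have pos: "eventually (\<lambda>x. x \<ge> 1) p" "eventually (\<lambda>x. x \<ge> 1) r" and bot: "p \<noteq> bot" "r \<noteq> bot"
    using p r by (auto simp: betaN_def ultrafilter_def)
  obtain c where c: "eventually (\<lambda>a. eventually
      (\<lambda>b. (LEAST k. less_exp n (n ^ a * b) mod n ^ k \<noteq> c k) = ndvd_exp n a) p) p"
    using star_shift_distance[where f = "less_exp n", OF n p less_exp_mult_power[OF n]] by blast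
  obtain d where d: "eventually (\<lambda>a. eventually
      (\<lambda>b. (LEAST k. ndvd_exp n (n ^ a * b) mod n ^ k \<noteq> d k) = ndvd_exp n a) p) p"
    using star_shift_distance[where f = "ndvd_exp n", OF n p ndvd_exp_mult_power[OF n]] by blast
  define F where "F x = (LEAST k. less_exp n x mod n ^ k \<noteq> c k)" for x
  define G where "G x = (LEAST k. ndvd_exp n x mod n ^ k \<noteq> d k)" for x
  have Fev: "eventually (\<lambda>a. eventually (\<lambda>b. F (n ^ a * b) = ndvd_exp n a) p) p"
    and Gev: "eventually (\<lambda>a. eventually (\<lambda>b. G (n ^ a * b) = ndvd_exp n a) p) p"
    using c d by (simp_all add: F_def G_def)
  have "eventually (\<lambda>a. eventually (\<lambda>b. F (n ^ a * b) = G (n ^ a * b)) p) p"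
    using Fev Gev
  proof eventually_elim
    case (elim a)
    then show ?case by eventually_elim simp
  qed
  then have "eventually (\<lambda>x. F x = G x) p"
    using eventually_beta_star[of "\<lambda>x. F x = G x" n p p] idem by simp
  then have "eventually (\<lambda>a. eventually (\<lambda>b. F (a + b) = G (a + b)) p) r"
    using eventually_beta_add[of "\<lambda>x. F x = G x" r p] fixed by simp
  \<comment> \<open>For \<open>b\<close> divisible by n^a, \<open>F (a + b)\<close> depends only on
    \<open>b\<close> and \<open>G (a + b)\<close> only on \<open>a\<close>.\<close>
  with pos(2) have "eventually (\<lambda>a. eventually (\<lambda>b. F b = G a) p) r"
  proof eventually_elim
    case (elim a)
    show ?case using elim(2) pos(1) star_idem_dvd[OF p idem, of a]
    proof eventually_elim
      case (elim b)
      then show ?case using n \<open>a \<ge> 1\<close> by (simp add: F_def G_def less_exp_add ndvd_exp_add)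
    qed
  qed
  \<comment> \<open>Fixing a single \<open>a\<close> makes \<open>F\<close> constant along
    \<open>p\<close>.\<close>
  then obtain a where "eventually (\<lambda>b. F b = G a) p"
    using bot(2) eventually_happens' by blast
  then have "eventually (\<lambda>a'. eventually (\<lambda>b. F (n ^ a' * b) = G a) p) p"
    using eventually_beta_star[of "\<lambda>x. F x = G a" n p p] idem by simp
  with Fev have "eventually (\<lambda>a'. ndvd_exp n a' = G a) p"
  proof eventually_elim
    case (elim a')
    then have "eventually (\<lambda>b. ndvd_exp n a' = G a) p" by eventually_elim simp
    then show ?case using bot(1) by simp
  qed
  \<comment> \<open>Divisibility by \<open>n ^ G a\<close> forces \<open>ndvd_exp n a'\<close> to be
    strictly larger than \<open>G a\<close>.\<close>
  with pos(1) star_idem_dvd[OF p idem, of "G a"] have "eventually (\<lambda>_. False) p"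
  proof eventually_elim
    case (elim a')
    then show ?case using n less_ndvd_exp_iff[of n a' "G a"] by simp
  qed
  then show False using bot(1) by (simp add: trivial_limit_def)
qed

theorem theorem1p11:
  fixes n :: nat
  assumes "n > 1"
  shows "\<not> (\<exists>p\<in>betaN. beta_star n p p = p \<and> p \<in> K_beta \<union> E_beta)"
proof
  assume "\<exists>p\<in>betaN. beta_star n p p = p \<and> p \<in> K_beta \<union> E_beta"
  then obtain p where p: "p \<in> betaN" "beta_star n p p = p" "p \<in> K_beta \<union> E_beta" by blast
  have "\<exists>r\<in>betaN. p = beta_add r p"
  proof (cases "p \<in> K_beta")
    case True
    then show ?thesis by (rule K_beta_left_fixed)
  next
    case False
    then have "p = beta_add p p" using p(3) by (simp add: E_beta_def)
    then show ?thesis using p(1) by blast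
  qed
  then show False using star_idem_not_left_fixed[OF assms p(1,2)] by blast
qed

end
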